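(* Let $R$ be a ring ($K$-algebra) with identity such that $\frac{1}{2}\in R$, and let $\sigma:R\longrightarrow R$ be an arbitrary endomorphism. For $r\in R$ the definition $$\Theta(r)=\frac{1}{2}\begin{bmatrix} r+\sigma(r) & r-\sigma(r)\\ r-\sigma(r) & r+\sigma(r)\end{bmatrix}$$ gives an embedding $\Theta:R\longrightarrow \mathrm{M}_{2}(R)$. If $\sigma$ is an involution ($\sigma^{2}=1$), then $\Theta$ is an embedding $R\longrightarrow \mathrm{M}_{2,1}^{\sigma}(R)$.
   Context: $K$ is a field of characteristic zero; the statement is made both for rings (with ring endomorphisms) and for $K$-algebras (with $K$-algebra endomorphisms). An involution here means a ring ($K$-algebra) endomorphism $\sigma$ with $\sigma^2=1$ (so it preserves the order of products; it is not an anti-automorphism). $\mathrm{M}_2(R)$ is the ring of $2\times 2$ matrices over $R$. $\mathrm{M}_{2,1}^{\sigma}(R)$ is the set of $(\sigma,2,1)$-supermatrices, i.e. the matrices $\begin{bmatrix} a & b\\ c& d\end{bmatrix}\in \mathrm{M}_2(R)$ with $\sigma(a)=a$, $\sigma(d)=d$, $\sigma(b)=-b$, $\sigma(c)=-c$; it is a subring (subalgebra) of $\mathrm{M}_2(R)$. An embedding is an injective ring ($K$-algebra) homomorphism. *)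

theory Defs
  imports "HOL-Analysis.Finite_Cartesian_Product" "HOL-Algebra.RingHom" "HOL-Algebra.Module"
begin

text \<open>Rings are the unital, not necessarily commutative rings of HOL-Algebra (the zero ring is
  allowed); \<^const>\<open>ring_hom\<close> consists of the homomorphisms preserving the identity.\<close>

definition ring_embedding ::
    "('a, 'm) ring_scheme \<Rightarrow> ('b, 'n) ring_scheme \<Rightarrow> ('a \<Rightarrow> 'b) \<Rightarrow> bool" where
  "ring_embedding R S f \<longleftrightarrow> ring_hom_ring R S f \<and> inj_on f (carrier R)"


text \<open>The locale \<open>algebra\<close> of HOL-Algebra requires the algebra to be commutative, so it cannot be
  used here.\<close>

definition unital_algebra ::
    "('k, 'n) ring_scheme \<Rightarrow> ('k, 'a, 'm) module_scheme \<Rightarrow> bool" where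
  "unital_algebra K A \<longleftrightarrow> Ring.field K \<and> Ring.ring A \<and> Module.module K A \<and>
     (\<forall>c\<in>carrier K. \<forall>x\<in>carrier A. \<forall>y\<in>carrier A.
        (c \<odot>\<^bsub>A\<^esub> x) \<otimes>\<^bsub>A\<^esub> y = c \<odot>\<^bsub>A\<^esub> (x \<otimes>\<^bsub>A\<^esub> y) \<and>
        x \<otimes>\<^bsub>A\<^esub> (c \<odot>\<^bsub>A\<^esub> y) = c \<odot>\<^bsub>A\<^esub> (x \<otimes>\<^bsub>A\<^esub> y))"

definition alg_hom ::
    "('k, 'n) ring_scheme \<Rightarrow> ('k, 'a, 'm) module_scheme \<Rightarrow> ('k, 'b, 'l) module_scheme
      \<Rightarrow> ('a \<Rightarrow> 'b) set" where
  "alg_hom K A B =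
     {f \<in> ring_hom A B. \<forall>c\<in>carrier K. \<forall>x\<in>carrier A. f (c \<odot>\<^bsub>A\<^esub> x) = c \<odot>\<^bsub>B\<^esub> f x}"

definition alg_embedding ::
    "('k, 'n) ring_scheme \<Rightarrow> ('k, 'a, 'm) module_scheme \<Rightarrow> ('k, 'b, 'l) module_scheme
      \<Rightarrow> ('a \<Rightarrow> 'b) \<Rightarrow> bool" where
  "alg_embedding K A B f \<longleftrightarrow>
     unital_algebra K A \<and> unital_algebra K B \<and> f \<in> alg_hom K A B \<and> inj_on f (carrier A)"

definition char_zero :: "('k, 'n) ring_scheme \<Rightarrow> bool" where
  "char_zero K \<longleftrightarrow> (\<forall>n::nat. n > 0 \<longrightarrow> [n] \<cdot>\<^bsub>K\<^esub> \<one>\<^bsub>K\<^esub> \<noteq> \<zero>\<^bsub>K\<^esub>)"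


text \<open>The ring of square matrices over \<open>R\<close>, indexed by the finite type \<open>'n\<close>. The matrix product
  of HOL-Analysis is not applicable, since it uses the type-class operations of the entries.\<close>

definition mat_ring :: "('a, 'm) ring_scheme \<Rightarrow> ('a^'n^'n) ring" where
  "mat_ring R =
     \<lparr> carrier = {A. \<forall>i j. A $ i $ j \<in> carrier R},
       mult = (\<lambda>A B. \<chi> i j. \<Oplus>\<^bsub>R\<^esub>k\<in>UNIV. A $ i $ k \<otimes>\<^bsub>R\<^esub> B $ k $ j),
       one = (\<chi> i j. if i = j then \<one>\<^bsub>R\<^esub> else \<zero>\<^bsub>R\<^esub>),
       zero = (\<chi> i j. \<zero>\<^bsub>R\<^esub>),
       add = (\<lambda>A B. \<chi> i j. A $ i $ j \<oplus>\<^bsub>R\<^esub> B $ i $ j) \<rparr>"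

definition mat_alg :: "('k, 'a, 'm) module_scheme \<Rightarrow> ('k, 'a^'n^'n) module" where
  "mat_alg A =
     \<lparr> carrier = carrier (mat_ring A),
       mult = mult (mat_ring A),
       one = one (mat_ring A),
       zero = zero (mat_ring A),
       add = add (mat_ring A),
       smult = (\<lambda>c X. \<chi> i j. c \<odot>\<^bsub>A\<^esub> X $ i $ j) \<rparr>"

definition mat2 :: "'a \<Rightarrow> 'a \<Rightarrow> 'a \<Rightarrow> 'a \<Rightarrow> 'a^2^2" where
  "mat2 a b c d =
     (\<chi> i j. if i = 1 then (if j = 1 then a else b) else (if j = 1 then c else d))"

text \<open>The carrier of \<open>M\<^sub>2\<^sub>,\<^sub>1\<^sup>\<sigma>(R)\<close>; its ring (algebra) structure is the one
  inherited from \<open>M\<^sub>2(R)\<close>.\<close>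

definition supermat :: "('a, 'm) ring_scheme \<Rightarrow> ('a \<Rightarrow> 'a) \<Rightarrow> ('a^2^2) set" where
  "supermat R \<sigma> =
     {mat2 a b c d | a b c d.
        a \<in> carrier R \<and> b \<in> carrier R \<and> c \<in> carrier R \<and> d \<in> carrier R \<and>
        \<sigma> a = a \<and> \<sigma> d = d \<and> \<sigma> b = \<ominus>\<^bsub>R\<^esub> b \<and> \<sigma> c = \<ominus>\<^bsub>R\<^esub> c}"

definition two :: "('a, 'm) ring_scheme \<Rightarrow> 'a" where
  "two R = \<one>\<^bsub>R\<^esub> \<oplus>\<^bsub>R\<^esub> \<one>\<^bsub>R\<^esub>"

definition Theta :: "('a, 'm) ring_scheme \<Rightarrow> ('a \<Rightarrow> 'a) \<Rightarrow> 'a \<Rightarrow> 'a^2^2" where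
  "Theta R \<sigma> r =
     (\<chi> i j. inv\<^bsub>R\<^esub> (two R) \<otimes>\<^bsub>R\<^esub>
        mat2 (r \<oplus>\<^bsub>R\<^esub> \<sigma> r) (r \<ominus>\<^bsub>R\<^esub> \<sigma> r)
             (r \<ominus>\<^bsub>R\<^esub> \<sigma> r) (r \<oplus>\<^bsub>R\<^esub> \<sigma> r) $ i $ j)"

end

theory Submission
  imports "HOL-Analysis.Cartesian_Space" Defs "HOL-Algebra.Subrings"
begin

text \<open>With \<open>p = (r + \<sigma> r) / 2\<close> and \<open>m = (r - \<sigma> r) / 2\<close> one has \<open>\<Theta> r = mat2 p m m p\<close>, and
  \<open>(p, m)\<close> is the unique pair with \<open>p + m = r\<close> and \<open>p - m = \<sigma> r\<close>. In other words, the matrices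
  \<open>mat2 p m m p\<close> form a subring isomorphic to \<open>R \<times> R\<close> via \<open>(p + m, p - m)\<close>, and \<open>\<Theta>\<close> corresponds
  to the graph embedding \<open>r \<mapsto> (r, \<sigma> r)\<close>.\<close>

section \<open>Matrix operations read entry by entry\<close>

lemma carrier_mat_ring: "X \<in> carrier (mat_ring R) \<longleftrightarrow> (\<forall>i j. X $ i $ j \<in> carrier R)"
  by (simp add: mat_ring_def)

lemma mat_ring_nth:
  "(X \<otimes>\<^bsub>mat_ring R\<^esub> Y) $ i $ j = (\<Oplus>\<^bsub>R\<^esub>k\<in>UNIV. X $ i $ k \<otimes>\<^bsub>R\<^esub> Y $ k $ j)"
  "(X \<oplus>\<^bsub>mat_ring R\<^esub> Y) $ i $ j = X $ i $ j \<oplus>\<^bsub>R\<^esub> Y $ i $ j"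
  "\<one>\<^bsub>mat_ring R\<^esub> $ i $ j = (if i = j then \<one>\<^bsub>R\<^esub> else \<zero>\<^bsub>R\<^esub>)"
  "\<zero>\<^bsub>mat_ring R\<^esub> $ i $ j = \<zero>\<^bsub>R\<^esub>"
  by (simp_all add: mat_ring_def)

lemma mat_alg_select:
  "carrier (mat_alg A) = carrier (mat_ring A)"
  "mult (mat_alg A) = mult (mat_ring A)"
  "add (mat_alg A) = add (mat_ring A)"
  "one (mat_alg A) = one (mat_ring A)"
  "zero (mat_alg A) = zero (mat_ring A)"
  by (simp_all add: mat_alg_def)

lemma smult_mat_alg_nth: "(c \<odot>\<^bsub>mat_alg A\<^esub> X) $ i $ j = c \<odot>\<^bsub>A\<^esub> X $ i $ j"
  by (simp add: mat_alg_def)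

lemma mat2_nth [simp]:
  "mat2 a b c d $ 1 $ 1 = a" "mat2 a b c d $ 1 $ 2 = b"
  "mat2 a b c d $ 2 $ 1 = c" "mat2 a b c d $ 2 $ 2 = d"
  by (simp_all add: mat2_def)

lemma mat2_eq_iff: "mat2 a b c d = mat2 a' b' c' d' \<longleftrightarrow> a = a' \<and> b = b' \<and> c = c' \<and> d = d'"
  by (metis mat2_nth)

lemma eq_mat2_iff:
  "X = mat2 a b c d \<longleftrightarrow> X $ 1 $ 1 = a \<and> X $ 1 $ 2 = b \<and> X $ 2 $ 1 = c \<and> X $ 2 $ 2 = d"
  by (auto simp: vec_eq_iff forall_2)

section \<open>Transfer between structures that share their operations\<close>

text \<open>The ring axioms mention only these five fields. This carries the ring structure from
  \<open>mat_ring A\<close> to \<open>mat_alg A\<close>, whose record type differs by the scalar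
  multiplication.\<close>

lemma ring_cong:
  fixes R (structure) and S (structure)
  assumes "ring R"
    and "carrier S = carrier R" "mult S = mult R" "add S = add R" "one S = one R" "zero S = zero R"
  shows "ring S"
proof -
  interpret ring R by fact
  show ?thesis
  proof (rule ringI)
    show "abelian_group S"
      by (rule abelian_groupI) (auto simp: assms(2-) a_ac intro: add.l_inv_ex)
    show "monoid S"
      by (rule monoidI) (auto simp: assms(2-) m_assoc)
  qed (simp_all add: assms(2-) l_distr r_distr)
qed

text \<open>Changing the carrier leaves the operations as they are, so only the closure condition
  changes. It serves to view \<open>Theta\<close> as a map into the supermatrices.\<close>

lemma ring_hom_restrict_codomain:
  assumes "f \<in> ring_hom R S" "f \<in> carrier R \<rightarrow> H"
  shows "f \<in> ring_hom R (S\<lparr>carrier := H\<rparr>)"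
  using assms by (auto simp: ring_hom_def)

text \<open>Negation is not a record field but a definite description built from these three fields,
  so the two descriptions coincide literally, for every \<open>x\<close>.\<close>

lemma a_inv_cong:
  assumes "carrier S = carrier R" "add S = add R" "zero S = zero R"
  shows "\<ominus>\<^bsub>S\<^esub> x = \<ominus>\<^bsub>R\<^esub> x"
  by (simp add: a_inv_def m_inv_def assms)

section \<open>Interchange of finite sums and the ring of square matrices\<close>

text \<open>Induction on \<open>A\<close>: adding an index \<open>a\<close> multiplies each inner
  product by \<open>f a j\<close>, and \<open>finprod_multf\<close> splits these factors off. The
  multiplicative form yields the additive one because \<open>finsum\<close> is
  \<open>finprod\<close> in the additive monoid.\<close>

lemma (in comm_monoid) finprod_finprod_swap:
  assumes "finite A" "finite B" "\<And>i j. i \<in> A \<Longrightarrow> j \<in> B \<Longrightarrow> f i j \<in> carrier G"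
  shows "finprod G (\<lambda>i. finprod G (f i) B) A = finprod G (\<lambda>j. finprod G (\<lambda>i. f i j) A) B"
  using assms(1,3)
proof (induction A)
  case empty
  then show ?case by simp
next
  case (insert a A)
  have [simp]: "(\<lambda>i. f i j) \<in> A \<rightarrow> carrier G" "f a j \<in> carrier G" if "j \<in> B" for j
    using insert.prems that by auto
  have "finprod G (\<lambda>j. finprod G (\<lambda>i. f i j) (insert a A)) B
      = finprod G (\<lambda>j. f a j \<otimes> finprod G (\<lambda>i. f i j) A) B"
    using insert by (intro finprod_cong') (auto simp: finprod_insert)
  also have "\<dots> = finprod G (f a) B \<otimes> finprod G (\<lambda>j. finprod G (\<lambda>i. f i j) A) B"
    by (intro finprod_multf) auto
  also have "\<dots> = finprod G (\<lambda>i. finprod G (f i) B) (insert a A)"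
    using insert by (subst finprod_insert) (auto intro!: finprod_closed)
  finally show ?case by simp
qed

context ring
begin

lemma finsum_finsum_swap:
  assumes "finite A" "finite B" "\<And>i j. i \<in> A \<Longrightarrow> j \<in> B \<Longrightarrow> f i j \<in> carrier R"
  shows "(\<Oplus>i\<in>A. \<Oplus>j\<in>B. f i j) = (\<Oplus>j\<in>B. \<Oplus>i\<in>A. f i j)"
  using add.finprod_finprod_swap[OF assms(1,2), of f] assms(3) by (simp add: finsum_def)

lemma finsum_UNIV_2:
  fixes f :: "2 \<Rightarrow> 'a"
  assumes "f 1 \<in> carrier R" "f 2 \<in> carrier R"
  shows "(\<Oplus>k\<in>UNIV. f k) = f 1 \<oplus> f 2"
  using assms by (simp add: UNIV_2)

text \<open>All axioms are checked on entries, over any finite index type. Associativity of the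
  product is an interchange of two finite sums; for the unit laws the Kronecker delta leaves a
  single summand.\<close>

lemma ring_mat_ring: "ring (mat_ring R :: ('a^'n^'n) ring)"
proof (rule ringI)
  show "abelian_group (mat_ring R :: ('a^'n^'n) ring)"
  proof (rule abelian_groupI)
    fix X :: "'a^'n^'n" assume X: "X \<in> carrier (mat_ring R)"
    show "\<exists>Y\<in>carrier (mat_ring R). Y \<oplus>\<^bsub>mat_ring R\<^esub> X = \<zero>\<^bsub>mat_ring R\<^esub>"
      using X by (intro bexI[of _ "\<chi> i j. \<ominus> X $ i $ j"])
        (auto simp: carrier_mat_ring vec_eq_iff mat_ring_nth l_neg)
  qed (auto simp: carrier_mat_ring vec_eq_iff mat_ring_nth a_ac)
  show "monoid (mat_ring R :: ('a^'n^'n) ring)"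
  proof (rule monoidI)
    fix X Y Z :: "'a^'n^'n"
    assume "X \<in> carrier (mat_ring R)" "Y \<in> carrier (mat_ring R)" "Z \<in> carrier (mat_ring R)"
    then have c: "X $ i $ j \<in> carrier R" "Y $ i $ j \<in> carrier R" "Z $ i $ j \<in> carrier R" for i j
      by (auto simp: carrier_mat_ring)
    have "(\<Oplus>k\<in>UNIV. (\<Oplus>l\<in>UNIV. X $ i $ l \<otimes> Y $ l $ k) \<otimes> Z $ k $ j)
        = (\<Oplus>l\<in>UNIV. X $ i $ l \<otimes> (\<Oplus>k\<in>UNIV. Y $ l $ k \<otimes> Z $ k $ j))" for i j
    proof -
      have "(\<Oplus>k\<in>UNIV. (\<Oplus>l\<in>UNIV. X $ i $ l \<otimes> Y $ l $ k) \<otimes> Z $ k $ j)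
          = (\<Oplus>k\<in>UNIV. \<Oplus>l\<in>UNIV. X $ i $ l \<otimes> (Y $ l $ k \<otimes> Z $ k $ j))"
        using c by (simp add: finsum_ldistr m_assoc)
      also have "\<dots> = (\<Oplus>l\<in>UNIV. \<Oplus>k\<in>UNIV. X $ i $ l \<otimes> (Y $ l $ k \<otimes> Z $ k $ j))"
        using c by (intro finsum_finsum_swap) auto
      also have "\<dots> = (\<Oplus>l\<in>UNIV. X $ i $ l \<otimes> (\<Oplus>k\<in>UNIV. Y $ l $ k \<otimes> Z $ k $ j))"
        using c by (simp add: finsum_rdistr)
      finally show ?thesis .
    qed
    then show "X \<otimes>\<^bsub>mat_ring R\<^esub> Y \<otimes>\<^bsub>mat_ring R\<^esub> Z = X \<otimes>\<^bsub>mat_ring R\<^esub> (Y \<otimes>\<^bsub>mat_ring R\<^esub> Z)"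
      by (simp add: vec_eq_iff mat_ring_nth)
  next
    fix X :: "'a^'n^'n" assume "X \<in> carrier (mat_ring R)"
    then have c: "X $ i $ j \<in> carrier R" for i j
      by (simp add: carrier_mat_ring)
    have "(\<Oplus>k\<in>UNIV. (if i = k then \<one> else \<zero>) \<otimes> X $ k $ j) = X $ i $ j" for i j
    proof -
      have "(\<Oplus>k\<in>UNIV. (if i = k then \<one> else \<zero>) \<otimes> X $ k $ j)
          = (\<Oplus>k\<in>UNIV. if i = k then X $ k $ j else \<zero>)"
        using c by (intro finsum_cong') auto
      also have "\<dots> = X $ i $ j"
        using c by (intro finsum_singleton) auto
      finally show ?thesis .
    qed
    then show "\<one>\<^bsub>mat_ring R\<^esub> \<otimes>\<^bsub>mat_ring R\<^esub> X = X"
      by (simp add: vec_eq_iff mat_ring_nth)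
    have "(\<Oplus>k\<in>UNIV. X $ i $ k \<otimes> (if k = j then \<one> else \<zero>)) = X $ i $ j" for i j
    proof -
      \<comment> \<open>The condition is turned round to \<open>j = k\<close>, the shape in which
        \<open>finsum_singleton\<close> collapses a sum over \<open>k\<close>.\<close>
      have "(\<Oplus>k\<in>UNIV. X $ i $ k \<otimes> (if k = j then \<one> else \<zero>))
          = (\<Oplus>k\<in>UNIV. if j = k then X $ i $ k else \<zero>)"
        using c by (intro finsum_cong') auto
      also have "\<dots> = X $ i $ j"
        using c by (intro finsum_singleton) auto
      finally show ?thesis .
    qed
    then show "X \<otimes>\<^bsub>mat_ring R\<^esub> \<one>\<^bsub>mat_ring R\<^esub> = X"
      by (simp add: vec_eq_iff mat_ring_nth)
  qed (auto simp: carrier_mat_ring mat_ring_nth intro!: finsum_closed)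
qed (auto simp: carrier_mat_ring vec_eq_iff mat_ring_nth l_distr r_distr finsum_addf)

text \<open>The matrix of negated entries is an additive inverse, and additive inverses in a ring
  are unique.\<close>

lemma a_inv_mat_ring_nth:
  fixes X :: "'a^'n^'n"
  assumes "X \<in> carrier (mat_ring R)"
  shows "(\<ominus>\<^bsub>mat_ring R\<^esub> X) $ i $ j = \<ominus> X $ i $ j"
proof -
  interpret M: ring "mat_ring R :: ('a^'n^'n) ring" by (rule ring_mat_ring)
  have "\<ominus>\<^bsub>mat_ring R\<^esub> X = (\<chi> i j. \<ominus> X $ i $ j)"
    using assms by (intro M.minus_equality)
      (auto simp: carrier_mat_ring vec_eq_iff mat_ring_nth l_neg)
  then show ?thesis by simp
qed

section \<open>Two-by-two matrices and supermatrices\<close>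

lemma mat2_carrier [simp]:
  "mat2 a b c d \<in> carrier (mat_ring R) \<longleftrightarrow>
     a \<in> carrier R \<and> b \<in> carrier R \<and> c \<in> carrier R \<and> d \<in> carrier R"
  by (auto simp: carrier_mat_ring forall_2)

lemma mat2_add: "mat2 a b c d \<oplus>\<^bsub>mat_ring R\<^esub> mat2 a' b' c' d' = mat2 (a \<oplus> a') (b \<oplus> b') (c \<oplus> c') (d \<oplus> d')"
  by (simp add: eq_mat2_iff mat_ring_nth)

lemma mat2_mult:
  assumes "a \<in> carrier R" "b \<in> carrier R" "c \<in> carrier R" "d \<in> carrier R"
    and "a' \<in> carrier R" "b' \<in> carrier R" "c' \<in> carrier R" "d' \<in> carrier R"
  shows "mat2 a b c d \<otimes>\<^bsub>mat_ring R\<^esub> mat2 a' b' c' d' =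
    mat2 (a \<otimes> a' \<oplus> b \<otimes> c') (a \<otimes> b' \<oplus> b \<otimes> d') (c \<otimes> a' \<oplus> d \<otimes> c') (c \<otimes> b' \<oplus> d \<otimes> d')"
  using assms by (simp add: eq_mat2_iff mat_ring_nth finsum_UNIV_2)

lemma mat2_one: "\<one>\<^bsub>mat_ring R\<^esub> = mat2 \<one> \<zero> \<zero> \<one>"
  by (simp add: eq_mat2_iff mat_ring_nth)

lemma mat2_minus:
  assumes "a \<in> carrier R" "b \<in> carrier R" "c \<in> carrier R" "d \<in> carrier R"
  shows "\<ominus>\<^bsub>mat_ring R\<^esub> mat2 a b c d = mat2 (\<ominus> a) (\<ominus> b) (\<ominus> c) (\<ominus> d)"
  using assms by (simp add: eq_mat2_iff a_inv_mat_ring_nth)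

lemma mat2_in_supermat:
  "mat2 a b c d \<in> supermat R \<sigma> \<longleftrightarrow>
     a \<in> carrier R \<and> b \<in> carrier R \<and> c \<in> carrier R \<and> d \<in> carrier R \<and>
     \<sigma> a = a \<and> \<sigma> d = d \<and> \<sigma> b = \<ominus> b \<and> \<sigma> c = \<ominus> c"
  by (auto simp: supermat_def mat2_eq_iff)

lemma supermatE:
  assumes "X \<in> supermat R \<sigma>"
  obtains a b c d where "X = mat2 a b c d"
    "a \<in> carrier R" "b \<in> carrier R" "c \<in> carrier R" "d \<in> carrier R"
    "\<sigma> a = a" "\<sigma> d = d" "\<sigma> b = \<ominus> b" "\<sigma> c = \<ominus> c"
  using assms by (auto simp: supermat_def)

text \<open>Call \<open>x\<close> even if \<sigma> fixes it and odd if \<sigma> negates it. As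
  \<sigma> is a homomorphism, sums and negatives keep parity, and products add parities. Hence sums,
  negatives and products of matrices with even diagonal and odd off-diagonal entries are again of
  this kind.\<close>

lemma subring_supermat:
  assumes "\<sigma> \<in> ring_hom R R"
  shows "subring (supermat R \<sigma>) (mat_ring R)"
proof -
  interpret M: ring "mat_ring R :: ('a^2^2) ring" by (rule ring_mat_ring)
  interpret \<sigma>: ring_hom_ring R R \<sigma>
    using assms by (intro ring_hom_ringI2) unfold_locales
  show ?thesis
  proof (rule M.subringI)
    show "supermat R \<sigma> \<subseteq> carrier (mat_ring R)"
      by (auto elim!: supermatE)
    show "\<one>\<^bsub>mat_ring R\<^esub> \<in> supermat R \<sigma>"
      by (simp add: mat2_one mat2_in_supermat)
  qed (auto elim!: supermatE simp: mat2_minus mat2_add mat2_mult mat2_in_supermat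
      l_minus r_minus minus_add a_comm)
qed

section \<open>Halving, and \<open>Theta\<close> over a ring in which 2 is invertible\<close>

context
  assumes two_unit: "two R \<in> Units R"
begin

lemma half_closed [simp]: "inv (two R) \<in> carrier R"
  using two_unit by simp

text \<open>Writing \<open>x \<oplus> x\<close> as \<open>two R \<otimes> x\<close> puts 2 directly
  beside its inverse, so the cancellation works without commutativity of multiplication.\<close>

lemma half_double:
  assumes "x \<in> carrier R"
  shows "inv (two R) \<otimes> (x \<oplus> x) = x"
proof -
  have "inv (two R) \<otimes> (x \<oplus> x) = inv (two R) \<otimes> (two R \<otimes> x)"
    using assms by (simp add: two_def l_distr)
  also have "\<dots> = x"
    using assms two_unit by (simp add: Units_closed flip: m_assoc)
  finally show ?thesis .
qed

text \<open>Adding \<open>p \<oplus> m\<close> and \<open>p \<ominus> m\<close> gives twice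
  \<open>p\<close>, subtracting them gives twice \<open>m\<close>. Thus a pair is determined by its
  sum and difference: this is the uniqueness behind the whole argument.\<close>

lemma half_unique:
  assumes "p \<in> carrier R" "m \<in> carrier R"
  shows "inv (two R) \<otimes> ((p \<oplus> m) \<oplus> (p \<ominus> m)) = p" "inv (two R) \<otimes> ((p \<oplus> m) \<ominus> (p \<ominus> m)) = m"
proof -
  have "(p \<oplus> m) \<oplus> (p \<ominus> m) = (p \<oplus> p) \<oplus> (m \<ominus> m)" "(p \<oplus> m) \<ominus> (p \<ominus> m) = (m \<oplus> m) \<oplus> (p \<ominus> p)"
    using assms by (simp_all only: a_minus_def minus_add minus_minus a_ac a_closed a_inv_closed)
  then have "(p \<oplus> m) \<oplus> (p \<ominus> m) = p \<oplus> p" "(p \<oplus> m) \<ominus> (p \<ominus> m) = m \<oplus> m"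
    using assms by (simp_all add: a_minus_def r_neg)
  then show "inv (two R) \<otimes> ((p \<oplus> m) \<oplus> (p \<ominus> m)) = p"
    "inv (two R) \<otimes> ((p \<oplus> m) \<ominus> (p \<ominus> m)) = m"
    using assms by (simp_all add: half_double)
qed

text \<open>The existence counterpart of \<open>half_unique\<close>: half the sum and half the
  difference of \<open>r\<close> and \<open>s\<close> are the required pair.\<close>

lemma half_cases:
  assumes "r \<in> carrier R" "s \<in> carrier R"
  obtains p m where "p \<in> carrier R" "m \<in> carrier R" "p \<oplus> m = r" "p \<ominus> m = s"
proof
  let ?h = "inv (two R)"
  show "?h \<otimes> (r \<oplus> s) \<in> carrier R" "?h \<otimes> (r \<ominus> s) \<in> carrier R"
    using assms by simp_all
  have "?h \<otimes> (r \<oplus> s) \<oplus> ?h \<otimes> (r \<ominus> s) = ?h \<otimes> ((r \<oplus> s) \<oplus> (r \<ominus> s))"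
    "?h \<otimes> (r \<oplus> s) \<ominus> ?h \<otimes> (r \<ominus> s) = ?h \<otimes> ((r \<oplus> s) \<ominus> (r \<ominus> s))"
    using assms by (simp_all add: r_distr r_minus a_minus_def)
  \<comment> \<open>Here \<open>half_unique\<close> is applied to the pair \<open>r\<close>,
    \<open>s\<close> itself: passing to sum and difference twice doubles both members of any
    pair.\<close>
  then show "?h \<otimes> (r \<oplus> s) \<oplus> ?h \<otimes> (r \<ominus> s) = r" "?h \<otimes> (r \<oplus> s) \<ominus> ?h \<otimes> (r \<ominus> s) = s"
    using assms by (simp_all add: half_unique)
qed

text \<open>The tool for evaluating \<open>Theta\<close>: once \<open>p\<close> and \<open>m\<close>
  are guessed, two equations free of the factor 1/2 remain to be checked.\<close>

lemma Theta_eqI: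
  assumes "p \<in> carrier R" "m \<in> carrier R" "p \<oplus> m = r" "p \<ominus> m = \<sigma> r"
  shows "Theta R \<sigma> r = mat2 p m m p"
  using half_unique[OF assms(1,2)] assms(3,4) by (simp add: Theta_def eq_mat2_iff)

lemma Theta_cases:
  assumes "r \<in> carrier R" "\<sigma> \<in> carrier R \<rightarrow> carrier R"
  obtains p m where "p \<in> carrier R" "m \<in> carrier R" "p \<oplus> m = r" "p \<ominus> m = \<sigma> r"
    "Theta R \<sigma> r = mat2 p m m p"
proof -
  obtain p m where "p \<in> carrier R" "m \<in> carrier R" "p \<oplus> m = r" "p \<ominus> m = \<sigma> r"
    using assms half_cases[of r "\<sigma> r"] by blast
  then show thesis
    using that Theta_eqI by blast
qed

text \<open>The element is recovered from its image as the sum \<open>p \<oplus> m\<close> of the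
  entries in the first row.\<close>

lemma inj_on_Theta:
  assumes "\<sigma> \<in> carrier R \<rightarrow> carrier R"
  shows "inj_on (Theta R \<sigma>) (carrier R)"
proof (rule inj_onI)
  fix r s assume "r \<in> carrier R" "s \<in> carrier R" "Theta R \<sigma> r = Theta R \<sigma> s"
  then show "r = s"
    by (metis Theta_cases[OF _ assms] mat2_eq_iff)
qed

text \<open>For the unit, sums and products the pair \<open>p\<close>, \<open>m\<close> is guessed
  from the expected matrix and confirmed by \<open>Theta_eqI\<close>; the difference equation is
  where multiplicativity or additivity of \<sigma> enters.\<close>

lemma Theta_hom:
  assumes "\<sigma> \<in> ring_hom R R"
  shows "Theta R \<sigma> \<in> ring_hom R (mat_ring R)"
proof (rule ring_hom_memI)
  interpret \<sigma>: ring_hom_ring R R \<sigma>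
    using assms by (intro ring_hom_ringI2) unfold_locales
  have \<sigma>: "\<sigma> \<in> carrier R \<rightarrow> carrier R" by auto
  \<comment> \<open>The pair is \<open>\<one>\<close>, \<open>\<zero>\<close>: both its sum and its
    difference are \<open>\<one>\<close>, which \<sigma> preserves.\<close>
  show "Theta R \<sigma> \<one> = \<one>\<^bsub>mat_ring R\<^esub>"
    unfolding mat2_one by (rule Theta_eqI) (auto simp: a_minus_def)
  fix r assume r: "r \<in> carrier R"
  obtain p m where pm: "p \<in> carrier R" "m \<in> carrier R" "p \<oplus> m = r" "p \<ominus> m = \<sigma> r"
    and Tr: "Theta R \<sigma> r = mat2 p m m p"
    using Theta_cases[OF r \<sigma>] .
  show "Theta R \<sigma> r \<in> carrier (mat_ring R)"
    using pm by (simp add: Tr)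
  fix s assume s: "s \<in> carrier R"
  obtain q n where qn: "q \<in> carrier R" "n \<in> carrier R" "q \<oplus> n = s" "q \<ominus> n = \<sigma> s"
    and Ts: "Theta R \<sigma> s = mat2 q n n q"
    using Theta_cases[OF s \<sigma>] .
  have "Theta R \<sigma> (r \<oplus> s) = mat2 (p \<oplus> q) (m \<oplus> n) (m \<oplus> n) (p \<oplus> q)"
  proof (rule Theta_eqI)
    show "p \<oplus> q \<oplus> (m \<oplus> n) = r \<oplus> s"
      unfolding pm(3)[symmetric] qn(3)[symmetric] using pm(1,2) qn(1,2) by (simp add: a_ac)
    have "\<sigma> (r \<oplus> s) = (p \<ominus> m) \<oplus> (q \<ominus> n)"
      using r s by (simp add: pm qn)
    then show "p \<oplus> q \<ominus> (m \<oplus> n) = \<sigma> (r \<oplus> s)"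
      using pm(1,2) qn(1,2) by (simp add: a_minus_def minus_add a_ac)
  qed (use pm qn in auto)
  then show "Theta R \<sigma> (r \<oplus> s) = Theta R \<sigma> r \<oplus>\<^bsub>mat_ring R\<^esub> Theta R \<sigma> s"
    by (simp add: Tr Ts mat2_add)
  \<comment> \<open>The entries are spelled exactly as \<open>mat2_mult\<close> produces them; the
    inner claim has the symmetric form that \<open>Theta_eqI\<close> demands, and the two differ
    only in the order of summands.\<close>
  have "Theta R \<sigma> (r \<otimes> s) = mat2 (p \<otimes> q \<oplus> m \<otimes> n) (p \<otimes> n \<oplus> m \<otimes> q) (m \<otimes> q \<oplus> p \<otimes> n) (m \<otimes> n \<oplus> p \<otimes> q)"
  proof -
    \<comment> \<open>Expanding \<open>(p \<oplus> m) \<otimes> (q \<oplus> n)\<close> and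
      \<open>(p \<ominus> m) \<otimes> (q \<ominus> n)\<close> gives the same four products; those
      with exactly one of \<open>m\<close>, \<open>n\<close> change sign and form the second member
      of the pair.\<close>
    have "Theta R \<sigma> (r \<otimes> s) = mat2 (p \<otimes> q \<oplus> m \<otimes> n) (p \<otimes> n \<oplus> m \<otimes> q) (p \<otimes> n \<oplus> m \<otimes> q) (p \<otimes> q \<oplus> m \<otimes> n)"
    proof (rule Theta_eqI)
      show "p \<otimes> q \<oplus> m \<otimes> n \<oplus> (p \<otimes> n \<oplus> m \<otimes> q) = r \<otimes> s"
        unfolding pm(3)[symmetric] qn(3)[symmetric] using pm(1,2) qn(1,2)
        by (simp add: a_ac l_distr r_distr)
      have "\<sigma> (r \<otimes> s) = (p \<ominus> m) \<otimes> (q \<ominus> n)"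
        using r s by (simp add: pm qn)
      then show "p \<otimes> q \<oplus> m \<otimes> n \<ominus> (p \<otimes> n \<oplus> m \<otimes> q) = \<sigma> (r \<otimes> s)"
        using pm(1,2) qn(1,2)
        by (simp add: a_minus_def minus_add a_ac l_distr r_distr l_minus r_minus)
    qed (use pm qn in auto)
    then show ?thesis
      using pm(1,2) qn(1,2) by (simp add: a_comm)
  qed
  then show "Theta R \<sigma> (r \<otimes> s) = Theta R \<sigma> r \<otimes>\<^bsub>mat_ring R\<^esub> Theta R \<sigma> s"
    using pm(1,2) qn(1,2) by (simp add: Tr Ts mat2_mult)
qed

text \<open>Applying \<open>\<sigma>\<close> to \<open>p + m = r\<close> and \<open>p - m = \<sigma> r\<close> swaps the right-hand sides, so
  \<open>(\<sigma> p, \<sigma> m) = (p, - m)\<close> by uniqueness.\<close>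

lemma Theta_in_supermat:
  assumes "\<sigma> \<in> ring_hom R R" "\<sigma> (\<sigma> r) = r" and r: "r \<in> carrier R"
  shows "Theta R \<sigma> r \<in> supermat R \<sigma>"
proof -
  interpret \<sigma>: ring_hom_ring R R \<sigma>
    using assms by (intro ring_hom_ringI2) unfold_locales
  obtain p m where pm: "p \<in> carrier R" "m \<in> carrier R" "p \<oplus> m = r" "p \<ominus> m = \<sigma> r"
    and T: "Theta R \<sigma> r = mat2 p m m p"
    using Theta_cases[OF r, of \<sigma>] by auto
  have "\<sigma> p \<oplus> \<sigma> m = \<sigma> (p \<oplus> m)" "\<sigma> p \<ominus> \<sigma> m = \<sigma> (p \<ominus> m)"
    using pm(1,2) by (simp_all add: a_minus_def)
  then have eqs: "\<sigma> p \<oplus> \<sigma> m = p \<ominus> m" "\<sigma> p \<ominus> \<sigma> m = p \<oplus> m"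
    using pm(3,4) assms(2) by simp_all
  have "\<sigma> p = inv (two R) \<otimes> ((p \<ominus> m) \<oplus> (p \<oplus> m))" "\<sigma> m = inv (two R) \<otimes> ((p \<ominus> m) \<ominus> (p \<oplus> m))"
    using half_unique[of "\<sigma> p" "\<sigma> m"] pm(1,2) by (simp_all only: eqs \<sigma>.hom_closed)
  \<comment> \<open>The pair \<open>p\<close>, \<open>\<ominus> m\<close> has sum
    \<open>p \<ominus> m\<close> and difference \<open>p \<oplus> m\<close>, the same as the pair
    \<open>\<sigma> p\<close>, \<open>\<sigma> m\<close>.\<close>
  moreover have "inv (two R) \<otimes> ((p \<ominus> m) \<oplus> (p \<oplus> m)) = p"
    "inv (two R) \<otimes> ((p \<ominus> m) \<ominus> (p \<oplus> m)) = \<ominus> m"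
    using half_unique[of p "\<ominus> m"] pm(1,2) by (simp_all add: a_minus_def)
  ultimately have "\<sigma> p = p" "\<sigma> m = \<ominus> m"
    by (simp_all only:)
  then show ?thesis
    using pm(1,2) by (simp add: T mat2_in_supermat)
qed

end

end

section \<open>Algebra structures and linearity of \<open>Theta\<close>\<close>

text \<open>The module axioms hold in each entry. Compatibility with the product follows by moving
  the scalar through the finite sum that defines an entry.\<close>

lemma unital_algebra_mat_alg:
  fixes K :: "('k, 'n) ring_scheme" and A :: "('k, 'a, 'm) module_scheme"
  assumes "unital_algebra K A"
  shows "unital_algebra K (mat_alg A :: ('k, 'a^'i^'i) module)"
proof -
  interpret K: field K using assms by (simp add: unital_algebra_def)
  interpret A: ring A using assms by (simp add: unital_algebra_def)
  interpret AM: module K A using assms by (simp add: unital_algebra_def)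
  have sm: "(c \<odot>\<^bsub>A\<^esub> x) \<otimes>\<^bsub>A\<^esub> y = c \<odot>\<^bsub>A\<^esub> (x \<otimes>\<^bsub>A\<^esub> y)"
    "x \<otimes>\<^bsub>A\<^esub> (c \<odot>\<^bsub>A\<^esub> y) = c \<odot>\<^bsub>A\<^esub> (x \<otimes>\<^bsub>A\<^esub> y)"
    if "c \<in> carrier K" "x \<in> carrier A" "y \<in> carrier A" for c x y
    using assms that by (auto simp: unital_algebra_def)
  interpret M: ring "mat_alg A :: ('k, 'a^'i^'i) module"
    by (rule ring_cong[OF A.ring_mat_ring]) (simp_all add: mat_alg_select)
  have "module K (mat_alg A :: ('k, 'a^'i^'i) module)"
  proof (rule moduleI)
    show "cring K" ..
    show "abelian_group (mat_alg A :: ('k, 'a^'i^'i) module)" ..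
  qed (auto simp: mat_alg_select carrier_mat_ring vec_eq_iff mat_ring_nth smult_mat_alg_nth
      AM.smult_l_distr AM.smult_r_distr AM.smult_assoc1)
  then show ?thesis
    unfolding unital_algebra_def
    by (auto simp: K.field_axioms M.ring_axioms mat_alg_select carrier_mat_ring vec_eq_iff
        mat_ring_nth smult_mat_alg_nth sm AM.finsum_smult_ldistr)
qed

text \<open>A subring stable under scalars is a submodule, and the compatibility laws are inherited
  from the larger carrier.\<close>

lemma unital_algebra_subalgebra:
  assumes "unital_algebra K A" "subring H A"
    and "\<And>c x. c \<in> carrier K \<Longrightarrow> x \<in> H \<Longrightarrow> c \<odot>\<^bsub>A\<^esub> x \<in> H"
  shows "unital_algebra K (A\<lparr>carrier := H\<rparr>)"
proof -
  interpret A: ring A using assms by (simp add: unital_algebra_def)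
  interpret AM: module K A using assms by (simp add: unital_algebra_def)
  have "submodule H K A"
    using subringE[OF assms(2)] assms(3) by (intro AM.submoduleI) auto
  then have "module K (A\<lparr>carrier := H\<rparr>)"
    by (rule submodule.submodule_is_module) (rule AM.module_axioms)
  then show ?thesis
    using assms(1) A.subring_is_ring[OF assms(2)] subringE(1)[OF assms(2)]
    by (auto simp: unital_algebra_def subset_iff)
qed

text \<open>Linearity of \<sigma> makes scaling preserve both the fixed and the negated elements, so
  the subring of supermatrices is stable under scalars.\<close>

lemma unital_algebra_supermat:
  fixes K :: "('k, 'n) ring_scheme" and A :: "('k, 'a, 'm) module_scheme"
  assumes A: "unital_algebra K A" and \<sigma>: "\<sigma> \<in> alg_hom K A A"
  shows "unital_algebra K ((mat_alg A)\<lparr>carrier := supermat A \<sigma>\<rparr>)"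
proof (rule unital_algebra_subalgebra[OF unital_algebra_mat_alg[OF A]])
  interpret A: ring A using A by (simp add: unital_algebra_def)
  interpret AM: module K A using A by (simp add: unital_algebra_def)
  interpret MA: ring "mat_alg A :: ('k, 'a^2^2) module"
    using unital_algebra_mat_alg[where 'i = 2, OF A] by (simp add: unital_algebra_def)
  have \<sigma>': "\<sigma> \<in> ring_hom A A"
    using \<sigma> by (simp add: alg_hom_def)
  note sub = subringE[OF A.subring_supermat[OF \<sigma>']]
  \<comment> \<open>The closure facts are known in \<open>mat_ring A\<close>. The fields agree by
    \<open>mat_alg_select\<close>; negation, being derived, is matched by
    \<open>a_inv_cong\<close>.\<close>
  show "subring (supermat A \<sigma>) (mat_alg A)"
    by (rule MA.subringI) (use sub in \<open>auto simp: mat_alg_select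
        a_inv_cong[of "mat_alg A" "mat_ring A"]\<close>)
  have smult_minus: "c \<odot>\<^bsub>A\<^esub> (\<ominus>\<^bsub>A\<^esub> x) = \<ominus>\<^bsub>A\<^esub> (c \<odot>\<^bsub>A\<^esub> x)"
    if "c \<in> carrier K" "x \<in> carrier A" for c x
    using that by (rule AM.smult_r_minus)
  fix c X assume c: "c \<in> carrier K" and "X \<in> supermat A \<sigma>"
  moreover have "\<sigma> (c \<odot>\<^bsub>A\<^esub> x) = c \<odot>\<^bsub>A\<^esub> \<sigma> x" if "x \<in> carrier A" for x
    using \<sigma> c that by (simp add: alg_hom_def)
  moreover have "c \<odot>\<^bsub>mat_alg A\<^esub> mat2 x y z w
      = mat2 (c \<odot>\<^bsub>A\<^esub> x) (c \<odot>\<^bsub>A\<^esub> y) (c \<odot>\<^bsub>A\<^esub> z) (c \<odot>\<^bsub>A\<^esub> w)" for x y z w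
    by (simp add: eq_mat2_iff smult_mat_alg_nth)
  ultimately show "c \<odot>\<^bsub>mat_alg A\<^esub> X \<in> supermat A \<sigma>"
    by (auto elim!: A.supermatE simp: A.mat2_in_supermat smult_minus)
qed

text \<open>If \<open>p\<close>, \<open>m\<close> is the pair of \<open>r\<close>, then scaling both
  by \<open>c\<close> gives the pair of the scaled element, because \<sigma> is linear;
  \<open>Theta_eqI\<close> turns this into linearity of \<open>Theta\<close>.\<close>

lemma Theta_alg_hom:
  assumes A: "unital_algebra K A" and two: "two A \<in> Units A" and \<sigma>: "\<sigma> \<in> alg_hom K A A"
  shows "Theta A \<sigma> \<in> alg_hom K A (mat_alg A)"
proof -
  interpret A: ring A using A by (simp add: unital_algebra_def)
  interpret AM: module K A using A by (simp add: unital_algebra_def)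
  have \<sigma>': "\<sigma> \<in> ring_hom A A"
    using \<sigma> by (simp add: alg_hom_def)
  have "Theta A \<sigma> \<in> ring_hom A (mat_alg A)"
    using A.Theta_hom[OF two \<sigma>'] by (simp add: ring_hom_def mat_alg_select)
  moreover have "Theta A \<sigma> (c \<odot>\<^bsub>A\<^esub> r) = c \<odot>\<^bsub>mat_alg A\<^esub> Theta A \<sigma> r"
    if c: "c \<in> carrier K" and r: "r \<in> carrier A" for c r
  proof -
    obtain p m where pm: "p \<in> carrier A" "m \<in> carrier A" "p \<oplus>\<^bsub>A\<^esub> m = r" "p \<ominus>\<^bsub>A\<^esub> m = \<sigma> r"
      and T: "Theta A \<sigma> r = mat2 p m m p"
      using A.Theta_cases[OF two r, of \<sigma>] \<sigma>' ring_hom_memE(1)[of \<sigma> A A] by blast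
    have "Theta A \<sigma> (c \<odot>\<^bsub>A\<^esub> r) = mat2 (c \<odot>\<^bsub>A\<^esub> p) (c \<odot>\<^bsub>A\<^esub> m) (c \<odot>\<^bsub>A\<^esub> m) (c \<odot>\<^bsub>A\<^esub> p)"
    proof (rule A.Theta_eqI[OF two])
      show "c \<odot>\<^bsub>A\<^esub> p \<oplus>\<^bsub>A\<^esub> c \<odot>\<^bsub>A\<^esub> m = c \<odot>\<^bsub>A\<^esub> r"
        using c pm(1,2) by (simp add: AM.smult_r_distr flip: pm(3))
      have "\<sigma> (c \<odot>\<^bsub>A\<^esub> r) = c \<odot>\<^bsub>A\<^esub> (p \<ominus>\<^bsub>A\<^esub> m)"
        using \<sigma> c r pm(4) by (simp add: alg_hom_def)
      then show "c \<odot>\<^bsub>A\<^esub> p \<ominus>\<^bsub>A\<^esub> c \<odot>\<^bsub>A\<^esub> m = \<sigma> (c \<odot>\<^bsub>A\<^esub> r)"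
        using c pm(1,2) by (simp add: a_minus_def AM.smult_r_distr AM.smult_r_minus)
    qed (use c pm in auto)
    then show ?thesis
      by (simp add: T vec_eq_iff forall_2 smult_mat_alg_nth)
  qed
  ultimately show ?thesis
    by (simp add: alg_hom_def)
qed

section \<open>The embeddings of rings and of algebras\<close>

theorem theorem3p2:
  fixes R :: "('r, 'm) ring_scheme"
    and K :: "('k, 'n) ring_scheme"
    and A :: "('k, 'a, 'l) module_scheme"
  shows
   "(\<forall>\<sigma>. Ring.ring R \<and> two R \<in> Units R \<and> \<sigma> \<in> ring_hom R R \<longrightarrow>
       ring_embedding R (mat_ring R) (Theta R \<sigma>) \<and>
       ((\<forall>r\<in>carrier R. \<sigma> (\<sigma> r) = r) \<longrightarrow>
          ring_embedding R ((mat_ring R)\<lparr>carrier := supermat R \<sigma>\<rparr>) (Theta R \<sigma>)))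
    \<and>
    (\<forall>\<sigma>. Ring.field K \<and> char_zero K \<and> unital_algebra K A \<and> two A \<in> Units A \<and>
       \<sigma> \<in> alg_hom K A A \<longrightarrow>
       alg_embedding K A (mat_alg A) (Theta A \<sigma>) \<and>
       ((\<forall>r\<in>carrier A. \<sigma> (\<sigma> r) = r) \<longrightarrow>
          alg_embedding K A ((mat_alg A)\<lparr>carrier := supermat A \<sigma>\<rparr>) (Theta A \<sigma>)))"
proof (intro conjI allI impI; (elim conjE)?)
  fix \<sigma>
  assume R: "ring R" and two: "two R \<in> Units R" and \<sigma>: "\<sigma> \<in> ring_hom R R"
  interpret R: ring R by (rule R)
  have inj: "inj_on (Theta R \<sigma>) (carrier R)"
    using \<sigma> by (intro R.inj_on_Theta[OF two]) (auto simp: ring_hom_def)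
  show "ring_embedding R (mat_ring R) (Theta R \<sigma>)"
    unfolding ring_embedding_def
    using inj R.ring_mat_ring R.Theta_hom[OF two \<sigma>] by (intro conjI ring_hom_ringI2 R)
  assume inv: "\<forall>r\<in>carrier R. \<sigma> (\<sigma> r) = r"
  \<comment> \<open>An embedding must have a ring as codomain; the subring property of the
    supermatrices supplies it.\<close>
  have "ring ((mat_ring R)\<lparr>carrier := supermat R \<sigma>\<rparr>)"
    by (intro ring.subring_is_ring R.ring_mat_ring R.subring_supermat \<sigma>)
  moreover have "Theta R \<sigma> \<in> ring_hom R ((mat_ring R)\<lparr>carrier := supermat R \<sigma>\<rparr>)"
    using inv by (intro ring_hom_restrict_codomain R.Theta_hom[OF two \<sigma>])
      (auto intro: R.Theta_in_supermat[OF two \<sigma>])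
  ultimately show "ring_embedding R ((mat_ring R)\<lparr>carrier := supermat R \<sigma>\<rparr>) (Theta R \<sigma>)"
    unfolding ring_embedding_def using inj by (intro conjI ring_hom_ringI2 R)
next
  fix \<sigma>
  assume A: "unital_algebra K A" and two: "two A \<in> Units A" and \<sigma>: "\<sigma> \<in> alg_hom K A A"
  interpret A: ring A using A by (simp add: unital_algebra_def)
  have \<sigma>': "\<sigma> \<in> ring_hom A A"
    using \<sigma> by (simp add: alg_hom_def)
  have inj: "inj_on (Theta A \<sigma>) (carrier A)"
    using \<sigma>' by (intro A.inj_on_Theta[OF two]) (auto simp: ring_hom_def)
  have hom: "Theta A \<sigma> \<in> alg_hom K A (mat_alg A)"
    by (rule Theta_alg_hom[OF A two \<sigma>])
  show "alg_embedding K A (mat_alg A) (Theta A \<sigma>)"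
    unfolding alg_embedding_def using A unital_algebra_mat_alg[OF A] hom inj by blast
  assume "\<forall>r\<in>carrier A. \<sigma> (\<sigma> r) = r"
  then have "Theta A \<sigma> \<in> carrier A \<rightarrow> supermat A \<sigma>"
    by (auto intro: A.Theta_in_supermat[OF two \<sigma>'])
  \<comment> \<open>Scalar multiplication is untouched by the smaller carrier, so linearity carries
    over and only the ring part is restricted.\<close>
  then have "Theta A \<sigma> \<in> alg_hom K A ((mat_alg A)\<lparr>carrier := supermat A \<sigma>\<rparr>)"
    using hom by (simp add: alg_hom_def ring_hom_restrict_codomain)
  then show "alg_embedding K A ((mat_alg A)\<lparr>carrier := supermat A \<sigma>\<rparr>) (Theta A \<sigma>)"
    unfolding alg_embedding_def using A unital_algebra_supermat[OF A \<sigma>] inj by blast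
qed

end
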